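(* For integers $k \geq 1$ and $n \geq 0$ let $f_k(n)$ denote the number of abelian squares of length $2n$ over an alphabet with $k$ letters. Then for all integers $k_1, k_2 \geq 1$ and $n \geq 0$, $$ f_{k_1+k_2}(n) = \sum_{0 \leq i \leq n} \binom{n}{i}^2 f_{k_1}(i) \, f_{k_2}(n-i). $$
   Context: An abelian square of length $2n$ is a string of the form $x x'$ where $|x| = |x'| = n$ and $x'$ is a permutation (rearrangement) of the symbols of $x$; equivalently, every letter of the alphabet occurs the same number of times in $x$ as in $x'$. The quantity $f_k(n)$ is the number of such strings over the alphabet $\{1, 2, \ldots, k\}$. By convention $f_k(0) = 1$ (the empty string is counted when $n = 0$). *)

theory Defs
  imports Complex_Main "HOL-Library.Multiset"
begin

(* "x' is a permutation of the symbols of x" is equality of the multisets of letters. *)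
definition abelian_square :: "nat \<Rightarrow> 'a list \<Rightarrow> bool" where
  "abelian_square n w \<longleftrightarrow>
     (\<exists>x x'. w = x @ x' \<and> length x = n \<and> length x' = n \<and> mset x' = mset x)"

definition num_abelian_squares :: "nat \<Rightarrow> nat \<Rightarrow> nat" where
  "num_abelian_squares k n = card {w :: nat list. set w \<subseteq> {1..k} \<and> abelian_square n w}"

(* card of an infinite set would be 0; this set is finite, so card is the true count. *)
lemma finite_abelian_squares:
  "finite {w :: nat list. set w \<subseteq> {1..k} \<and> abelian_square n w}"
  by (rule finite_subset[OF _ finite_lists_length_eq[of "{1..k}" "2 * n"]])
     (auto simp: abelian_square_def)

lemma num_abelian_squares_0: "num_abelian_squares k 0 = 1"
proof -
  have "{w :: nat list. set w \<subseteq> {1..k} \<and> abelian_square 0 w} = {[]}"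
    by (auto simp: abelian_square_def)
  then show ?thesis
    by (simp add: num_abelian_squares_def)
qed

end

theory Submission
  imports Defs "HOL-Combinatorics.Multiset_Permutations"
begin

text \<open>
  Grouping abelian squares by the common letter multiset of their two halves shows that the
  number of them is the sum of the squares of the multinomial coefficients. A multiset over a
  disjoint union of two alphabets splits uniquely into its two parts, and the multinomial
  coefficient of the whole is a binomial coefficient times those of the parts.
\<close>

text \<open>Arbitrary letter sets instead of \<open>{1..k}\<close>: the argument cuts an alphabet
  into two disjoint pieces, and the second piece is not an initial segment.\<close>

definition abelian_squares_over :: "'a set \<Rightarrow> nat \<Rightarrow> 'a list set" where
  "abelian_squares_over A n = {w. set w \<subseteq> A \<and> abelian_square n w}"

text \<open>Once the common multiset \<open>M\<close> of the halves is fixed, the two halves are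
  independent orderings of \<open>M\<close>, hence the square.\<close>

lemma card_abelian_squares_over:
  assumes "finite A"
  shows "card (abelian_squares_over A n) =
    (\<Sum>M\<in>multisets_of_size A n. (card (permutations_of_multiset M))\<^sup>2)"
proof -
  let ?S = "SIGMA M:multisets_of_size A n. permutations_of_multiset M \<times> permutations_of_multiset M"
  have "bij_betw (\<lambda>(M, x, y). x @ y) ?S (abelian_squares_over A n)"
    unfolding bij_betw_def
  proof
    show "inj_on (\<lambda>(M, x, y). x @ y) ?S"
    proof (rule inj_onI)
      fix p q
      assume pq: "p \<in> ?S" "q \<in> ?S" and eq: "(case p of (M, x, y) \<Rightarrow> x @ y) = (case q of (M, x, y) \<Rightarrow> x @ y)"
      obtain M x y M' x' y' where p: "p = (M, x, y)" and q: "q = (M', x', y')"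
        by (metis prod_cases3)
      have mset: "mset x = M" "mset x' = M'"
        using pq by (auto simp: p q permutations_of_multiset_def)
      moreover have "size M = n" "size M' = n"
        using pq by (auto simp: p q multisets_of_size_def)
      \<comment> \<open>Both words are cut at position \<open>n\<close>, so equal words have equal
        halves, and the halves determine the multiset.\<close>
      ultimately have "length x = length x'"
        by (metis size_mset)
      with eq have "x = x'" "y = y'"
        by (simp_all add: p q)
      with mset show "p = q"
        by (simp add: p q)
    qed
    show "(\<lambda>(M, x, y). x @ y) ` ?S = abelian_squares_over A n"
    proof
      show "(\<lambda>(M, x, y). x @ y) ` ?S \<subseteq> abelian_squares_over A n"
      proof clarify
        fix M x y
        assume "M \<in> multisets_of_size A n"
          "x \<in> permutations_of_multiset M" "y \<in> permutations_of_multiset M"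
        then have "mset x = M" "mset y = M" "set_mset M \<subseteq> A" "size M = n"
          by (auto simp: multisets_of_size_def permutations_of_multiset_def)
        then have "set x \<subseteq> A" "set y \<subseteq> A" "length x = n" "length y = n" "mset y = mset x"
          by (metis set_mset_mset size_mset)+
        then show "x @ y \<in> abelian_squares_over A n"
          by (auto simp: abelian_squares_over_def abelian_square_def)
      qed
      show "abelian_squares_over A n \<subseteq> (\<lambda>(M, x, y). x @ y) ` ?S"
      proof
        fix w assume "w \<in> abelian_squares_over A n"
        then obtain x y where "w = x @ y" "length x = n" "mset y = mset x" "set w \<subseteq> A"
          by (auto simp: abelian_squares_over_def abelian_square_def)
        then show "w \<in> (\<lambda>(M, x, y). x @ y) ` ?S"
          by (intro image_eqI[of _ _ "(mset x, x, y)"])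
            (auto simp: multisets_of_size_def permutations_of_multiset_def)
      qed
    qed
  qed
  then have "card (abelian_squares_over A n) = card ?S"
    by (rule bij_betw_same_card[symmetric])
  also have "\<dots> = (\<Sum>M\<in>multisets_of_size A n. (card (permutations_of_multiset M))\<^sup>2)"
    using finite_multisets_of_size[OF assms]
    by (subst card_SigmaI) (auto simp: card_cartesian_product power2_eq_square)
  finally show ?thesis .
qed

lemma abelian_square_map:
  assumes "abelian_square n w"
  shows "abelian_square n (map f w)"
  using assms unfolding abelian_square_def by (metis length_map map_append mset_map)

text \<open>An injective renaming of letters acts bijectively on words and keeps the halves
  rearrangements of each other. This will bring a shifted alphabet back to an initial
  segment.\<close>

lemma card_abelian_squares_over_image:
  fixes f :: "'a \<Rightarrow> 'b"
  assumes "inj f"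
  shows "card (abelian_squares_over (f ` A) n) = card (abelian_squares_over A n)"
proof -
  have "abelian_squares_over (f ` A) n = map f ` abelian_squares_over A n"
  proof
    show "map f ` abelian_squares_over A n \<subseteq> abelian_squares_over (f ` A) n"
      by (auto simp: abelian_squares_over_def abelian_square_map image_subset_iff)
    show "abelian_squares_over (f ` A) n \<subseteq> map f ` abelian_squares_over A n"
    proof
      fix w assume "w \<in> abelian_squares_over (f ` A) n"
      then have "set w \<subseteq> f ` A" "abelian_square n w"
        by (auto simp: abelian_squares_over_def)
      \<comment> \<open>The preimage word arises by applying \<open>inv f\<close> letterwise; by
        injectivity of \<open>f\<close> its letters lie in \<open>A\<close>.\<close>
      moreover have "map f (map (inv f) w) = w"
        using \<open>set w \<subseteq> f ` A\<close> by (auto intro!: map_idI simp: f_inv_into_f)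
      ultimately show "w \<in> map f ` abelian_squares_over A n"
        using assms
        by (intro image_eqI[of _ _ "map (inv f) w"])
          (auto simp: abelian_squares_over_def abelian_square_map)
    qed
  qed
  then show ?thesis
    using assms by (simp add: card_image inj_on_subset[OF inj_mapI])
qed

text \<open>To arrange \<open>M + N\<close>, choose the positions taken by letters of
  \<open>M\<close>, then order each part. The proof is arithmetical: it uses the multinomial
  formula, whose denominator \<open>?d\<close> is multiplicative because each letter occurs in only
  one of the parts.\<close>

lemma card_permutations_of_multiset_add_disjoint:
  assumes "set_mset M \<inter> set_mset N = {}"
  shows "card (permutations_of_multiset (M + N)) =
    (size (M + N) choose size M) * card (permutations_of_multiset M) * card (permutations_of_multiset N)"
proof -
  let ?c = "\<lambda>M. card (permutations_of_multiset M)"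
  let ?d = "\<lambda>M. \<Prod>x\<in>set_mset M. fact (count M x) :: nat"
  have d: "?d (M + N) = ?d M * ?d N"
  proof -
    have "?d (M + N) = (\<Prod>x\<in>set_mset M. fact (count (M + N) x)) * (\<Prod>x\<in>set_mset N. fact (count (M + N) x))"
      using assms by (simp add: prod.union_disjoint)
    also have "(\<Prod>x\<in>set_mset M. fact (count (M + N) x)) = ?d M"
      using assms by (intro prod.cong) (auto simp: disjoint_iff not_in_iff)
    also have "(\<Prod>x\<in>set_mset N. fact (count (M + N) x)) = ?d N"
    proof (rule prod.cong[OF refl])
      fix x assume "x \<in># N"
      then have "count M x = 0"
        using assms by (auto simp: count_eq_zero_iff)
      then show "fact (count (M + N) x) = (fact (count N x) :: nat)"
        by simp
    qed
    finally show ?thesis .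
  qed
  \<comment> \<open>The formula is used with denominators cleared, which avoids division on
    \<open>nat\<close>; the nonzero factor \<open>?d M * ?d N\<close> is cancelled at the
    end.\<close>
  have "?c (M + N) * (?d M * ?d N) = fact (size (M + N))"
    using card_permutations_of_multiset_aux[of "M + N"] by (simp only: d)
  also have "\<dots> = fact (size M) * fact (size N) * (size (M + N) choose size M)"
    using binomial_fact_lemma[of "size M" "size (M + N)"] by simp
  also have "\<dots> = ?c M * ?d M * (?c N * ?d N) * (size (M + N) choose size M)"
    by (simp only: card_permutations_of_multiset_aux)
  finally have "?c (M + N) * (?d M * ?d N) =
      (size (M + N) choose size M) * ?c M * ?c N * (?d M * ?d N)"
    by (simp only: mult_ac)
  moreover have "?d M * ?d N \<noteq> 0" by simp
  ultimately show ?thesis by (metis mult_right_cancel)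
qed

lemma card_abelian_squares_over_union:
  assumes "finite A" "finite B" "A \<inter> B = {}"
  shows "card (abelian_squares_over (A \<union> B) n) =
    (\<Sum>i = 0..n. (n choose i)\<^sup>2 * card (abelian_squares_over A i) * card (abelian_squares_over B (n - i)))"
proof -
  let ?c = "\<lambda>M. card (permutations_of_multiset M)"
  \<comment> \<open>The index \<open>i\<close> is determined by \<open>M\<close>, but carrying it
    along lets the sum later be taken over \<open>i\<close> first.\<close>
  let ?S = "SIGMA i:{0..n}. multisets_of_size A i \<times> multisets_of_size B (n - i)"
  have disj: "set_mset M \<inter> set_mset N = {}"
    if "M \<in> multisets_of_size A i" "N \<in> multisets_of_size B j" for M N i j
    using that assms(3) by (auto simp: multisets_of_size_def)
  have count_outside: "count M x = 0" if "M \<in> multisets_of_size C i" "x \<notin> C" for C M i x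
    using that by (auto simp: multisets_of_size_def count_eq_zero_iff)
  have filter_part: "filter_mset (\<lambda>x. x \<in> A) M = M" "filter_mset (\<lambda>x. x \<notin> A) M = {#}"
    if "M \<in> multisets_of_size A i" for M i
    using that by (simp_all add: multiset_eq_iff count_outside)
  have filter_other: "filter_mset (\<lambda>x. x \<notin> A) M = M" "filter_mset (\<lambda>x. x \<in> A) M = {#}"
    if "M \<in> multisets_of_size B i" for M i
    using that assms(3) by (auto simp: multiset_eq_iff count_outside disjoint_iff)
  have "card (abelian_squares_over (A \<union> B) n) = (\<Sum>M\<in>multisets_of_size (A \<union> B) n. (?c M)\<^sup>2)"
    using assms by (simp add: card_abelian_squares_over)
  also have "\<dots> = (\<Sum>(i, M, N)\<in>?S. (?c (M + N))\<^sup>2)"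
  \<comment> \<open>The inverse of adding the two parts separates letters in \<open>A\<close> from
    all others. Complementary filters always add up to \<open>M\<close>; for a multiset over
    \<open>A \<union> B\<close> the second one keeps only letters of \<open>B\<close>.\<close>
  proof (rule sum.reindex_bij_witness[where
        i = "\<lambda>(i, M, N). M + N" and
        j = "\<lambda>M. (size (filter_mset (\<lambda>x. x \<in> A) M), filter_mset (\<lambda>x. x \<in> A) M, filter_mset (\<lambda>x. x \<notin> A) M)"])
    fix M assume M: "M \<in> multisets_of_size (A \<union> B) n"
    have "size (filter_mset (\<lambda>x. x \<in> A) M) + size (filter_mset (\<lambda>x. x \<notin> A) M) = size M"
      by (simp flip: size_union multiset_partition)
    then show "(size (filter_mset (\<lambda>x. x \<in> A) M), filter_mset (\<lambda>x. x \<in> A) M, filter_mset (\<lambda>x. x \<notin> A) M) \<in> ?S"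
      using M by (auto simp: multisets_of_size_def)
    show "(\<lambda>(i, M, N). M + N) (size (filter_mset (\<lambda>x. x \<in> A) M), filter_mset (\<lambda>x. x \<in> A) M, filter_mset (\<lambda>x. x \<notin> A) M) = M"
      by (simp flip: multiset_partition)
    show "(case (size (filter_mset (\<lambda>x. x \<in> A) M), filter_mset (\<lambda>x. x \<in> A) M, filter_mset (\<lambda>x. x \<notin> A) M) of
        (i, M, N) \<Rightarrow> (?c (M + N))\<^sup>2) = (?c M)\<^sup>2"
      by (simp flip: multiset_partition)
  next
    fix p assume "p \<in> ?S"
    then obtain i M N where p: "p = (i, M, N)" "i \<le> n"
      and M: "M \<in> multisets_of_size A i" and N: "N \<in> multisets_of_size B (n - i)"
      by auto
    show "(\<lambda>(i, M, N). M + N) p \<in> multisets_of_size (A \<union> B) n"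
      using p M N by (auto simp: multisets_of_size_def)
    show "(\<lambda>M. (size (filter_mset (\<lambda>x. x \<in> A) M), filter_mset (\<lambda>x. x \<in> A) M, filter_mset (\<lambda>x. x \<notin> A) M))
        ((\<lambda>(i, M, N). M + N) p) = p"
      using multisets_of_size_size[OF M]
      by (simp add: p filter_part[OF M] filter_other[OF N])
  qed
  also have "\<dots> = (\<Sum>(i, M, N)\<in>?S. (n choose i)\<^sup>2 * (?c M)\<^sup>2 * (?c N)\<^sup>2)"
  proof (rule sum.cong[OF refl], clarify)
    fix i M N
    assume i: "i \<in> {0..n}" and M: "M \<in> multisets_of_size A i" and N: "N \<in> multisets_of_size B (n - i)"
    then have "size M = i" "size (M + N) = n" by (auto simp: multisets_of_size_def)
    then show "(?c (M + N))\<^sup>2 = (n choose i)\<^sup>2 * (?c M)\<^sup>2 * (?c N)\<^sup>2"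
      by (simp only: card_permutations_of_multiset_add_disjoint[OF disj[OF M N]] power_mult_distrib)
  qed
  also have "\<dots> = (\<Sum>i = 0..n. \<Sum>(M, N)\<in>multisets_of_size A i \<times> multisets_of_size B (n - i).
      (n choose i)\<^sup>2 * (?c M)\<^sup>2 * (?c N)\<^sup>2)"
    using assms by (subst sum.Sigma) (auto simp: finite_multisets_of_size)
  also have "\<dots> = (\<Sum>i = 0..n. (n choose i)\<^sup>2 * card (abelian_squares_over A i) * card (abelian_squares_over B (n - i)))"
    \<comment> \<open>For fixed \<open>i\<close> the summand is a constant times a function of
      \<open>M\<close> times a function of \<open>N\<close>, so the double sum is a product of two
      sums of squares.\<close>
    by (simp only: card_abelian_squares_over[OF assms(1)] card_abelian_squares_over[OF assms(2)]
        mult.assoc sum_product flip: sum.cartesian_product) (simp only: sum_distrib_left)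
  finally show ?thesis .
qed

theorem mainTheorem3:
  fixes k1 k2 n :: nat
  assumes "k1 \<ge> 1" and "k2 \<ge> 1"
  shows "num_abelian_squares (k1 + k2) n =
    (\<Sum>i = 0..n. (n choose i)\<^sup>2 * num_abelian_squares k1 i * num_abelian_squares k2 (n - i))"
proof -
  have num: "num_abelian_squares k m = card (abelian_squares_over {1..k} m)" for k m
    by (simp add: num_abelian_squares_def abelian_squares_over_def)
  have inj: "inj ((+) k1)"
    by simp
  \<comment> \<open>The last \<open>k2\<close> letters are written as a shift of
    \<open>{1..k2}\<close>, so that the renaming lemma applies to them.\<close>
  have "card (abelian_squares_over ({1..k1} \<union> (+) k1 ` {1..k2}) n) =
    (\<Sum>i = 0..n. (n choose i)\<^sup>2 * card (abelian_squares_over {1..k1} i) *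
      card (abelian_squares_over ((+) k1 ` {1..k2}) (n - i)))"
    by (rule card_abelian_squares_over_union) auto
  moreover have "{1..k1 + k2} = {1..k1} \<union> (+) k1 ` {1..k2}"
    by auto
  ultimately show ?thesis
    by (simp only: num card_abelian_squares_over_image inj)
qed

end
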